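(* Let $G$ be a locally compact group with a left Haar measure $\mu$, and let $K\ge1$. Suppose $S\subseteq G$ is a precompact symmetric open set containing the identity such that $\mu(S^{2n})\le K\mu(S^n)$ for some integer $n\ge 8K^4$. Then $\mu(S^{3n})\le(2^{12}K^{24})^{10\cdot5^{4K^4}}\mu(S^n)$, and $S^{2n}$ is a precompact open $(2^{12}K^{24})^{30\cdot5^{4K^4}}$-approximate group.
   Context: A left Haar measure satisfies $\mu(xA)=\mu(A)$ for all measurable $A\subseteq G$ and $x\in G$. For a set $S$ and integer $m\ge1$, $S^m=\{s_1\cdots s_m: s_i\in S\}$. A set $S$ is symmetric if $S=S^{-1}$. For $L\ge1$, an $L$-approximate group is a symmetric subset $A$ of a group containing the identity such that $A^2$ is covered by at most $L$ left translates $xA$ of $A$. *)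

theory Defs
  imports "HOL-Analysis.Analysis" "HOL-Algebra.Coset"
begin

locale topological_group = group G for G (structure) +
  fixes T :: "'a topology"
  assumes topspace_eq: "topspace T = carrier G"
    and continuous_mult: "continuous_map (prod_topology T T) T (\<lambda>(x, y). x \<otimes> y)"
    and continuous_inv: "continuous_map T T (\<lambda>x. inv x)"

(* The Hausdorff axiom is not part of the definition, so results stated for this locale
   cover in particular locally compact Hausdorff groups. *)
locale locally_compact_group = topological_group +
  assumes locally_compact: "locally_compact_space T"

(* Nonzero left-invariant Radon measure on the Borel sets of T. Compact sets need not be
   closed when T is not Hausdorff, hence the conditions C \<in> sets \<mu>; they are
   redundant in the Hausdorff case. *)
locale left_haar_measure = topological_group +
  fixes \<mu> :: "'a measure"
  assumes space_eq: "space \<mu> = carrier G"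
    and sets_eq: "sets \<mu> = sigma_sets (topspace T) {U. openin T U}"
    and nonzero: "emeasure \<mu> (carrier G) \<noteq> 0"
    and finite_on_compact:
      "\<And>C. \<lbrakk>compactin T C; C \<in> sets \<mu>\<rbrakk> \<Longrightarrow> emeasure \<mu> C < \<infinity>"
    and outer_regular:
      "\<And>A. A \<in> sets \<mu> \<Longrightarrow> emeasure \<mu> A = (INF U\<in>{U. openin T U \<and> A \<subseteq> U}. emeasure \<mu> U)"
    and inner_regular:
      "\<And>U. openin T U \<Longrightarrow>
         emeasure \<mu> U = (SUP C\<in>{C. compactin T C \<and> C \<in> sets \<mu> \<and> C \<subseteq> U}. emeasure \<mu> C)"
    and left_invariant:
      "\<And>x A. \<lbrakk>x \<in> carrier G; A \<in> sets \<mu>\<rbrakk> \<Longrightarrow> emeasure \<mu> (x <# A) = emeasure \<mu> A"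

definition precompactin :: "'a topology \<Rightarrow> 'a set \<Rightarrow> bool" where
  "precompactin T S \<longleftrightarrow> S \<subseteq> topspace T \<and> compactin T (T closure_of S)"

(* Only exponents m >= 1 occur; set_power G S 0 is the trivial subgroup. *)
primrec set_power :: "('a, 'b) monoid_scheme \<Rightarrow> 'a set \<Rightarrow> nat \<Rightarrow> 'a set" where
  "set_power G S 0 = {\<one>\<^bsub>G\<^esub>}"
| "set_power G S (Suc m) = set_power G S m <#>\<^bsub>G\<^esub> S"

definition symmetric_in :: "('a, 'b) monoid_scheme \<Rightarrow> 'a set \<Rightarrow> bool" where
  "symmetric_in G S \<longleftrightarrow> S \<subseteq> carrier G \<and> set_inv\<^bsub>G\<^esub> S = S"

definition approximate_group :: "('a, 'b) monoid_scheme \<Rightarrow> real \<Rightarrow> 'a set \<Rightarrow> bool" where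
  "approximate_group G L A \<longleftrightarrow>
     1 \<le> L \<and> symmetric_in G A \<and> \<one>\<^bsub>G\<^esub> \<in> A \<and>
     (\<exists>X. finite X \<and> X \<subseteq> carrier G \<and> real (card X) \<le> L \<and>
          set_power G A 2 \<subseteq> (\<Union>x\<in>X. x <#\<^bsub>G\<^esub> A))"

end

(* Put A = S^n, so that mu(A A) <= K mu(A), and let H be the set of x for which A and xA overlap in
   measure at least mu(A) / (4 K). A maximal almost disjoint family of translates of A inside A A
   gives A <= X H with |X| <= 2 K, and a pigeonhole argument covers H^m by K (4 K^2)^m translates
   of A A. Whenever two cells x H and y H with x, y in X are close, drop y and replace H by H^5: after
   at most |X| steps the cells x H' that remain are well separated, where H' = H^q with
   q <= 5^|X|. The set of cells met by S^r must stop growing at some r < |X| <= n / 2, whence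
   S^n <= S^r H'^2, and inductively S^((j + 1) n) <= S^n H'^(4 j) <= X H'^(4 j + 1). Both claims follow
   from the covering of H^m, with j = 2 and j = 3. *)
theory Submission
  imports Defs
begin

section \<open>Products, inverses and powers of subsets of a group\<close>

lemma set_multI: "\<lbrakk>a \<in> A; b \<in> B\<rbrakk> \<Longrightarrow> a \<otimes>\<^bsub>G\<^esub> b \<in> A <#>\<^bsub>G\<^esub> B"
  unfolding set_mult_def by blast

lemma set_multE:
  assumes "x \<in> A <#>\<^bsub>G\<^esub> B"
  obtains a b where "a \<in> A" "b \<in> B" "x = a \<otimes>\<^bsub>G\<^esub> b"
  using assms unfolding set_mult_def by blast

lemma set_mult_eq_UN_l_coset: "A <#>\<^bsub>G\<^esub> B = (\<Union>a\<in>A. a <#\<^bsub>G\<^esub> B)"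
  unfolding set_mult_def l_coset_def by blast

context group
begin

lemma one_set_mult: "A \<subseteq> carrier G \<Longrightarrow> {\<one>} <#> A = A"
  unfolding set_mult_def by force

lemma set_mult_one: "A \<subseteq> carrier G \<Longrightarrow> A <#> {\<one>} = A"
  unfolding set_mult_def by force

lemma mem_l_coset_iff:
  "\<lbrakk>x \<in> carrier G; A \<subseteq> carrier G\<rbrakk> \<Longrightarrow> y \<in> x <# A \<longleftrightarrow> y \<in> carrier G \<and> inv x \<otimes> y \<in> A"
  unfolding l_coset_def by (auto simp: subset_eq m_assoc[symmetric] intro!: bexI[of _ "inv x \<otimes> y"])

lemma symmetric_inD: "\<lbrakk>symmetric_in G A; x \<in> A\<rbrakk> \<Longrightarrow> inv x \<in> A"
  unfolding symmetric_in_def SET_INV_def by blast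

lemma symmetric_inI:
  assumes "A \<subseteq> carrier G" "\<And>x. x \<in> A \<Longrightarrow> inv x \<in> A"
  shows "symmetric_in G A"
proof -
  have "x \<in> set_inv A" if "x \<in> A" for x
    using assms that unfolding SET_INV_def by (auto intro!: bexI[of _ "inv x"])
  then show ?thesis
    using assms unfolding symmetric_in_def SET_INV_def by blast
qed

lemma set_power_closed: "S \<subseteq> carrier G \<Longrightarrow> set_power G S m \<subseteq> carrier G"
  by (induction m) (simp_all add: set_mult_closed)

lemma set_power_add:
  "S \<subseteq> carrier G \<Longrightarrow> set_power G S (m + k) = set_power G S m <#> set_power G S k"
  by (induction k) (simp_all add: set_mult_one set_power_closed set_mult_assoc)

lemma set_power_mult:
  "S \<subseteq> carrier G \<Longrightarrow> set_power G (set_power G S m) k = set_power G S (m * k)"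
  by (induction k) (simp_all add: set_power_add[symmetric] add.commute)

lemma set_power_mono:
  assumes "S \<subseteq> carrier G" "\<one> \<in> S" "m \<le> k"
  shows "set_power G S m \<subseteq> set_power G S k"
  using \<open>m \<le> k\<close>
proof (induction k rule: dec_induct)
  case (step k)
  have "x \<in> set_power G S (Suc k)" if "x \<in> set_power G S k" for x
    using set_multI[OF that assms(2), of G] set_power_closed[OF assms(1), of k] that by auto
  then show ?case
    using step by blast
qed simp

lemma one_mem_set_power: "\<one> \<in> S \<Longrightarrow> \<one> \<in> set_power G S m"
  by (induction m) (use set_multI[of \<one> _ \<one> _ G] in auto)

lemma symmetric_in_set_power:
  assumes "symmetric_in G S"
  shows "symmetric_in G (set_power G S m)"
proof -
  have S: "S \<subseteq> carrier G"
    using assms by (simp add: symmetric_in_def)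
  have "inv x \<in> set_power G S m" if "x \<in> set_power G S m" for x
    using that
  proof (induction m arbitrary: x)
    case (Suc m)
    then obtain a b where ab: "a \<in> set_power G S m" "b \<in> S" "x = a \<otimes> b"
      by (auto elim: set_multE)
    \<comment> \<open>Inversion reverses the factors, so \<open>inv b\<close> has to stand in front,
      whereas \<open>set_power\<close> appends on the right; \<open>set_power_add\<close> with
      \<open>1 + m\<close> reconciles the two.\<close>
    have "inv x = inv b \<otimes> inv a"
      using ab S set_power_closed[OF S, of m] by (simp add: inv_mult_group subset_eq)
    moreover have "inv b \<in> set_power G S 1"
      using ab S assms by (simp add: symmetric_inD one_set_mult)
    ultimately have "inv x \<in> set_power G S (1 + m)"
      unfolding set_power_add[OF S] using Suc.IH ab(1) by (auto intro: set_multI)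
    then show ?case
      by simp
  qed simp
  then show ?thesis
    by (intro symmetric_inI set_power_closed S)
qed

section \<open>Separated cells and the growth of powers\<close>

lemma separated_subcover:
  assumes "finite X" "X \<subseteq> carrier G" "symmetric_in G H" "\<one> \<in> H" "A \<subseteq> X <#> H"
  shows "\<exists>Y q. Y \<subseteq> X \<and> 1 \<le> q \<and> q \<le> 5 ^ card X \<and> A \<subseteq> Y <#> set_power G H q
    \<and> (\<forall>x\<in>Y. \<forall>y\<in>Y. x \<noteq> y \<longrightarrow> inv x \<otimes> y \<notin> set_power G H (4 * q))"
  using assms
proof (induction "card X" arbitrary: X H)
  case 0
  then show ?case
    by (intro exI[of _ X] exI[of _ 1]) (auto simp: one_set_mult symmetric_in_def)
next
  case (Suc c)
  have H: "H \<subseteq> carrier G"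
    using Suc.prems by (simp add: symmetric_in_def)
  show ?case
  proof (cases "\<forall>x\<in>X. \<forall>y\<in>X. x \<noteq> y \<longrightarrow> inv x \<otimes> y \<notin> set_power G H 4")
    case True
    then show ?thesis
      using Suc.prems H by (intro exI[of _ X] exI[of _ 1]) (auto simp: one_set_mult)
  next
    case False
    then obtain x y where xy: "x \<in> X" "y \<in> X" "x \<noteq> y" "inv x \<otimes> y \<in> set_power G H 4"
      by blast
    let ?H = "set_power G H 5"
    have cover: "X <#> H \<subseteq> (X - {y}) <#> ?H"
    proof
      fix z
      assume "z \<in> X <#> H"
      then obtain u h where uh: "u \<in> X" "h \<in> H" "z = u \<otimes> h"
        by (rule set_multE)
      show "z \<in> (X - {y}) <#> ?H"
      proof (cases "u = y")
        case True
        have c: "x \<in> carrier G" "y \<in> carrier G" "h \<in> carrier G"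
          using xy uh H Suc.prems by auto
        have "z = x \<otimes> (inv x \<otimes> y \<otimes> h)"
          using c by (simp add: uh True m_assoc[symmetric])
        moreover have "inv x \<otimes> y \<otimes> h \<in> ?H"
          using set_multI[OF xy(4) uh(2), of G] by (simp add: numeral_eq_Suc)
        ultimately show ?thesis
          using xy by (auto intro: set_multI)
      next
        case False
        have "h \<in> ?H"
          using set_power_mono[OF H \<open>\<one> \<in> H\<close>, of 1 5] uh H by (auto simp: one_set_mult)
        then show ?thesis
          using uh False by (auto intro: set_multI)
      qed
    qed
    have c: "c = card (X - {y})"
      using Suc.hyps(2) xy by simp
    have "\<exists>Y q. Y \<subseteq> X - {y} \<and> 1 \<le> q \<and> q \<le> 5 ^ card (X - {y}) \<and>
        A \<subseteq> Y <#> set_power G ?H q \<and>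
        (\<forall>x\<in>Y. \<forall>y\<in>Y. x \<noteq> y \<longrightarrow> inv x \<otimes> y \<notin> set_power G ?H (4 * q))"
    proof (rule Suc.hyps(1)[OF c])
      show "A \<subseteq> (X - {y}) <#> ?H"
        using Suc.prems(5) cover by (rule order_trans)
    qed (use Suc.prems in \<open>simp_all add: one_mem_set_power symmetric_in_set_power Diff_subset
          subset_trans[OF Diff_subset] del: set_power.simps\<close>)
    then obtain Y q where Y: "Y \<subseteq> X - {y}" "1 \<le> q"
      "q \<le> 5 ^ card (X - {y})" "A \<subseteq> Y <#> set_power G ?H q"
      "\<forall>x\<in>Y. \<forall>y\<in>Y. x \<noteq> y \<longrightarrow> inv x \<otimes> y \<notin> set_power G ?H (4 * q)"
      by (elim exE conjE)
    have "5 * q \<le> 5 ^ card X"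
      using Y(3) Suc.hyps(2) c by (metis power_Suc mult_le_mono2)
    then show ?thesis
      using Y by (intro exI[of _ Y] exI[of _ "5 * q"])
        (auto simp: set_power_mult H mult.left_commute)
  qed
qed

text \<open>Only \<open>card X\<close> cells are available, so the set of cells met by \<open>S\<^sup>r\<close> must stop growing at
  some \<open>r < card X\<close>; separation then prevents it from ever growing again up to time \<open>n\<close>.\<close>
lemma power_subset_thickened_power:
  assumes "finite X" "X \<subseteq> carrier G" "symmetric_in G H" "\<one> \<in> H" "S \<subseteq> carrier G" "\<one> \<in> S"
    and cover: "set_power G S n \<subseteq> X <#> H"
    and sep: "\<forall>x\<in>X. \<forall>y\<in>X. x \<noteq> y \<longrightarrow> inv x \<otimes> y \<notin> set_power G H 4"
    and "card X \<le> n"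
  obtains r where "r < card X" "set_power G S n \<subseteq> set_power G S r <#> set_power G H 2"
proof -
  have H: "H \<subseteq> carrier G"
    using assms by (simp add: symmetric_in_def)
  note Hc = set_power_closed[OF H] and Sc = set_power_closed[OF \<open>S \<subseteq> carrier G\<close>]
  \<comment> \<open>\<open>Y r\<close> is the set of cells met by S^r, each cell x H being named by
    its centre x.\<close>
  define Y where "Y r = {x\<in>X. \<exists>h\<in>H. x \<otimes> h \<in> set_power G S r}" for r
  have Y_mono: "Y r \<subseteq> Y (Suc r)" for r
    using set_power_mono[OF \<open>S \<subseteq> carrier G\<close> \<open>\<one> \<in> S\<close>, of r "Suc r"] unfolding Y_def by fastforce
  have finY: "finite (Y r)" for r
    using assms by (simp add: Y_def)
  have in_Y: "set_power G S r \<subseteq> Y r <#> H" if "r \<le> n" for r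
  proof
    fix z
    assume z: "z \<in> set_power G S r"
    then have "z \<in> X <#> H"
      using set_power_mono[of S r n] that assms by blast
    then obtain x h where "x \<in> X" "h \<in> H" "z = x \<otimes> h"
      by (rule set_multE)
    then show "z \<in> Y r <#> H"
      using z by (auto simp: Y_def intro: set_multI)
  qed
  \<comment> \<open>The centre x need not lie in S^r, but some x h with h in H does. Writing x g =
    (x h) (h^-1 g) trades the centre for that point at the cost of one more factor H.\<close>
  have Y_sub: "Y r <#> set_power G H k \<subseteq> set_power G S r <#> set_power G H (Suc k)" for r k
  proof
    fix z
    assume "z \<in> Y r <#> set_power G H k"
    then obtain x g where xg: "x \<in> Y r" "g \<in> set_power G H k" "z = x \<otimes> g"
      by (rule set_multE)
    then obtain h where h: "x \<in> X" "h \<in> H" "x \<otimes> h \<in> set_power G S r"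
      by (auto simp: Y_def)
    have c: "x \<in> carrier G" "h \<in> carrier G" "g \<in> carrier G"
      using h xg H assms subsetD[OF Hc] by auto
    have "z = (x \<otimes> h) \<otimes> (inv h \<otimes> g)"
      using c by (simp add: xg m_assoc[symmetric] inv_solve_right') (simp add: m_assoc)
    moreover have "inv h \<otimes> g \<in> set_power G H (1 + k)"
      unfolding set_power_add[OF H] using h xg assms symmetric_inD H
      by (auto intro!: set_multI simp: one_set_mult)
    ultimately show "z \<in> set_power G S r <#> set_power G H (Suc k)"
      using h by (auto intro: set_multI simp del: set_power.simps)
  qed
  have "\<exists>r < card X. Y (Suc r) = Y r"
  proof (rule ccontr)
    assume "\<not> ?thesis"
    then have grow: "card (Y r) < card (Y (Suc r))" if "r < card X" for r
      using that Y_mono finY by (metis psubset_card_mono psubsetI)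
    \<comment> \<open>\<open>Y 0\<close> is nonempty since S^0 contains the identity, so strict
      growth up to time \<open>card X\<close> would produce more than \<open>card X\<close>
      cells.\<close>
    have "r < card (Y r)" if "r \<le> card X" for r
      using that
    proof (induction r)
      case 0
      have "\<one> \<in> Y 0 <#> H"
        using in_Y[of 0] by simp
      then have "Y 0 \<noteq> {}"
        by (auto elim: set_multE)
      then show ?case
        using finY by (simp add: card_gt_0_iff)
    next
      case (Suc r)
      then show ?case
        using grow[of r] by simp
    qed
    moreover have "card (Y (card X)) \<le> card X"
      using assms by (intro card_mono) (auto simp: Y_def)
    ultimately show False
      by (meson leD order_refl)
  qed
  then obtain r where r: "r < card X" "Y (Suc r) = Y r"
    by blast
  \<comment> \<open>A point x h of S^(s+1) is s1 u with u in S^s, and by induction u = v g with v in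
    S^r and g in H^2. Now s1 v lies in S^(r+1), hence in a cell y H with y in \<open>Y r\<close>,
    because growth stopped there. So y^-1 x is a product of one, two and one factors from H, and
    separation forces y = x.\<close>
  have "Y s \<subseteq> Y r" if "Suc r \<le> s" "s \<le> n" for s
    using that
  proof (induction s rule: dec_induct)
    case (step s)
    show ?case
    proof
      fix x
      assume "x \<in> Y (Suc s)"
      then obtain h where xh: "x \<in> X" "h \<in> H" "x \<otimes> h \<in> set_power G S (1 + s)"
        by (auto simp: Y_def)
      then obtain s1 u where u: "s1 \<in> S" "u \<in> set_power G S s" "x \<otimes> h = s1 \<otimes> u"
        unfolding set_power_add[OF \<open>S \<subseteq> carrier G\<close>] using assms by (auto elim!: set_multE simp: one_set_mult)
      have "u \<in> Y s <#> H"
        using u in_Y[of s] step by auto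
      then have "u \<in> Y r <#> set_power G H 1"
        using mono_set_mult[OF step.IH order_refl, of G H] step H by (auto simp: one_set_mult)
      then have "u \<in> set_power G S r <#> set_power G H 2"
        using Y_sub[of r 1] by (auto simp: numeral_2_eq_2)
      then obtain v g where v: "v \<in> set_power G S r" "g \<in> set_power G H 2" "u = v \<otimes> g"
        by (rule set_multE)
      have "s1 \<otimes> v \<in> set_power G S (1 + r)"
        unfolding set_power_add[OF \<open>S \<subseteq> carrier G\<close>] using u v assms
        by (auto intro!: set_multI simp: one_set_mult)
      then have "s1 \<otimes> v \<in> Y r <#> H"
        using in_Y[of "Suc r"] r \<open>card X \<le> n\<close> by auto
      then obtain y k where y: "y \<in> Y r" "k \<in> H" "s1 \<otimes> v = y \<otimes> k"
        by (rule set_multE)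
      have yX: "y \<in> X"
        using y by (simp add: Y_def)
      have c: "x \<in> carrier G" "y \<in> carrier G" "h \<in> carrier G" "k \<in> carrier G" "g \<in> carrier G"
        "s1 \<in> carrier G" "v \<in> carrier G"
        using xh y yX v u assms H subsetD[OF Hc] subsetD[OF Sc] by auto
      have "x \<otimes> h = y \<otimes> k \<otimes> g"
        using u v y c by (simp add: m_assoc[symmetric])
      then have "x = y \<otimes> (k \<otimes> g \<otimes> inv h)"
        using c by (metis inv_closed inv_solve_right m_assoc m_closed)
      then have "inv y \<otimes> x = k \<otimes> g \<otimes> inv h"
        using c by (metis inv_closed inv_solve_left m_closed)
      moreover have "k \<otimes> g \<otimes> inv h \<in> set_power G H (1 + 2 + 1)"
        unfolding set_power_add[OF H] using y v xh assms symmetric_inD H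
        by (auto intro!: set_multI simp: one_set_mult)
      ultimately have "inv y \<otimes> x \<in> set_power G H 4"
        by (simp add: numeral_eq_Suc)
      then have "y = x"
        using sep xh yX by blast
      then show "x \<in> Y r"
        using y by simp
    qed
  qed (simp add: r)
  then have "Y n \<subseteq> Y r"
    using r \<open>card X \<le> n\<close> by (meson Suc_leI le_trans order_refl)
  then have "set_power G S n \<subseteq> Y r <#> H"
    using in_Y[of n] mono_set_mult[OF _ order_refl, of "Y n" "Y r" G H] by blast
  then have "set_power G S n \<subseteq> set_power G S r <#> set_power G H 2"
    using Y_sub[of r 1] H by (auto simp: one_set_mult numeral_2_eq_2)
  then show thesis
    using that r by blast
qed

text \<open>Powers of S commute with each other, so the factors H can be kept on the right: S^n S^n
  is contained in S^n S^r H^2 = S^r S^n H^2, hence in S^(2r) H^4, hence in S^n H^4. Each further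
  factor S^n therefore costs four factors H.\<close>

lemma power_subset_thickening:
  assumes "S \<subseteq> carrier G" "\<one> \<in> S" "H \<subseteq> carrier G"
    and sub: "set_power G S n \<subseteq> set_power G S r <#> set_power G H 2" and "2 * r \<le> n"
  shows "set_power G S (Suc j * n) \<subseteq> set_power G S n <#> set_power G H (4 * j)"
proof (induction j)
  case 0
  show ?case
    using assms by (simp add: set_mult_one set_power_closed)
next
  case (Suc j)
  let ?P = "set_power G S" and ?H = "set_power G H"
  note cl = set_power_closed[OF assms(1)] set_power_closed[OF assms(3)] set_mult_closed
  have "?P n <#> ?P n \<subseteq> ?P n <#> (?P r <#> ?H 2)"
    using sub by (intro mono_set_mult) auto
  also have "\<dots> = ?P r <#> ?P n <#> ?H 2"
    by (simp add: set_mult_assoc[symmetric] cl set_power_add[OF assms(1), symmetric] add.commute)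
  also have "\<dots> \<subseteq> ?P r <#> (?P r <#> ?H 2) <#> ?H 2"
    using sub by (intro mono_set_mult) auto
  also have "\<dots> = ?P (2 * r) <#> ?H 4"
    by (simp add: set_mult_assoc cl set_power_add[OF assms(1)] set_power_add[OF assms(3), symmetric]
        mult_2)
  also have "\<dots> \<subseteq> ?P n <#> ?H 4"
    using assms by (intro mono_set_mult[OF set_power_mono order_refl]) auto
  finally have base: "?P n <#> ?P n \<subseteq> ?P n <#> ?H 4" .
  have "?P (Suc (Suc j) * n) = ?P n <#> ?P (Suc j * n)"
    by (simp add: set_power_add[OF assms(1), symmetric])
  also have "\<dots> \<subseteq> ?P n <#> (?P n <#> ?H (4 * j))"
    using Suc by (intro mono_set_mult) auto
  also have "\<dots> = ?P n <#> ?P n <#> ?H (4 * j)"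
    by (simp add: set_mult_assoc cl)
  also have "\<dots> \<subseteq> ?P n <#> ?H 4 <#> ?H (4 * j)"
    using base by (rule mono_set_mult) simp
  also have "\<dots> = ?P n <#> ?H (4 * Suc j)"
    by (simp add: set_mult_assoc cl set_power_add[OF assms(3)])
  finally show ?case .
qed

end

section \<open>Maximal separated families and a pigeonhole principle for measures\<close>

text \<open>The uniform bound on cardinalities yields a separated family of greatest cardinality,
  and no point can be added to it. It is applied below to almost disjoint and to disjoint
  translates.\<close>

lemma maximal_separated:
  fixes N :: real
  assumes bound: "\<And>F. \<lbrakk>finite F; F \<subseteq> A; pairwise P F\<rbrakk> \<Longrightarrow> real (card F) \<le> N" and "symp P"
  obtains F where "finite F" "F \<subseteq> A" "pairwise P F" "\<And>a. a \<in> A - F \<Longrightarrow> \<exists>f\<in>F. \<not> P f a"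
proof -
  let ?Q = "\<lambda>F. finite F \<and> F \<subseteq> A \<and> pairwise P F"
  have "?Q {}"
    by simp
  moreover have "\<forall>F. ?Q F \<longrightarrow> card F < Suc (nat \<lfloor>N\<rfloor>)"
    using bound by (auto simp: le_nat_floor less_Suc_eq_le)
  ultimately have "\<exists>F. ?Q F \<and> (\<forall>F'. ?Q F' \<longrightarrow> card F' \<le> card F)"
    by (rule ex_has_greatest_nat)
  then obtain F where F: "?Q F" and max: "\<And>F'. ?Q F' \<Longrightarrow> card F' \<le> card F"
    by blast
  have "\<exists>f\<in>F. \<not> P f a" if a: "a \<in> A - F" for a
  proof (rule ccontr)
    assume "\<not> ?thesis"
    then have "?Q (insert a F)"
      using F a \<open>symp P\<close> by (auto simp: pairwise_insert dest: sympD)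
    then show False
      using max[of "insert a F"] F a by simp
  qed
  then show thesis
    using that F by blast
qed

text \<open>The sum of the measures is the integral of the function counting the sets
  \<open>E i\<close> through a point. This function vanishes off B and is bounded by
  \<open>card I\<close>, so it has a maximum on B; b is a point where the maximum is
  attained.\<close>

lemma measure_pigeonhole:
  assumes "finite I" "\<And>i. i \<in> I \<Longrightarrow> E i \<in> sets M" "\<And>i. i \<in> I \<Longrightarrow> E i \<subseteq> B"
    and B: "B \<in> fmeasurable M" "B \<noteq> {}"
  obtains b where "b \<in> B"
    "(\<Sum>i\<in>I. measure M (E i)) \<le> real (card {i\<in>I. b \<in> E i}) * measure M B"
proof -
  let ?c = "\<lambda>b. card {i\<in>I. b \<in> E i}"
  obtain b0 where "b0 \<in> B"
    using B by blast
  moreover have "\<forall>b. b \<in> B \<longrightarrow> ?c b < Suc (card I)"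
    using \<open>finite I\<close> by (auto simp: less_Suc_eq_le intro: card_mono)
  ultimately have "\<exists>b. b \<in> B \<and> (\<forall>b'. b' \<in> B \<longrightarrow> ?c b' \<le> ?c b)"
    by (rule ex_has_greatest_nat)
  then obtain b where b: "b \<in> B" "\<And>b'. b' \<in> B \<Longrightarrow> ?c b' \<le> ?c b"
    by blast
  have E: "E i \<in> fmeasurable M" if "i \<in> I" for i
    using assms(2,3) that by (intro fmeasurableI2[OF B(1)])
  then have int: "integrable M (\<lambda>x. indicator (E i) x :: real)" if "i \<in> I" for i
    using that by (simp add: fmeasurable_def)
  have "(\<Sum>i\<in>I. measure M (E i)) = (\<Sum>i\<in>I. \<integral>x. indicator (E i) x \<partial>M)"
    using E by (intro sum.cong refl) (simp add: Int_absorb2 fmeasurableD sets.sets_into_space)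
  also have "\<dots> = (\<integral>x. (\<Sum>i\<in>I. indicator (E i) x) \<partial>M)"
    using int by (intro Bochner_Integration.integral_sum[symmetric])
  also have "\<dots> \<le> (\<integral>x. real (?c b) * indicator B x \<partial>M)"
  proof (rule integral_mono)
    show "integrable M (\<lambda>x. \<Sum>i\<in>I. indicator (E i) x :: real)"
      using int by (intro Bochner_Integration.integrable_sum)
    show "integrable M (\<lambda>x. real (?c b) * indicator B x)"
      using B by (simp add: fmeasurable_def)
    fix x
    have sum_eq: "(\<Sum>i\<in>I. indicator (E i) x :: real) = real (?c x)"
      using \<open>finite I\<close> by (simp add: indicator_def sum.If_cases Int_def)
    show "(\<Sum>i\<in>I. indicator (E i) x) \<le> real (?c b) * indicator B x"
    proof (cases "x \<in> B")
      case False
      then have empty: "{i\<in>I. x \<in> E i} = {}"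
        using assms(3) by blast
      show ?thesis
        unfolding sum_eq empty by simp
    qed (use sum_eq b(2) in simp)
  qed
  also have "\<dots> = real (?c b) * measure M B"
    using B by (simp add: Int_absorb2 fmeasurableD sets.sets_into_space)
  finally show thesis
    using that b by blast
qed

section \<open>Topology of translates, products and powers\<close>

context group
begin

lemma l_coset_Int:
  "\<lbrakk>x \<in> carrier G; A \<subseteq> carrier G; B \<subseteq> carrier G\<rbrakk> \<Longrightarrow> x <# (A \<inter> B) = (x <# A) \<inter> (x <# B)"
  by (auto simp: mem_l_coset_iff le_infI1)

lemma l_coset_closed: "\<lbrakk>x \<in> carrier G; A \<subseteq> carrier G\<rbrakk> \<Longrightarrow> x <# A \<subseteq> carrier G"
  by (auto simp: mem_l_coset_iff)

lemma l_coset_subset_set_mult: "x \<in> A \<Longrightarrow> x <# B \<subseteq> A <#> B"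
  by (auto simp: set_mult_eq_UN_l_coset)

end

context topological_group
begin

lemma openin_imp_subset_carrier: "openin T U \<Longrightarrow> U \<subseteq> carrier G"
  using openin_subset topspace_eq by blast

lemma openin_l_coset:
  assumes "x \<in> carrier G" "openin T A"
  shows "openin T (x <# A)"
proof -
  have "continuous_map T (prod_topology T T) (\<lambda>y. (inv x, y))"
    using assms(1) by (intro continuous_map_pairedI) (simp_all add: topspace_eq)
  from continuous_map_compose[OF this continuous_mult]
  have "continuous_map T T (\<lambda>y. inv x \<otimes> y)"
    by (simp add: o_def)
  from openin_continuous_map_preimage[OF this assms(2)]
  show ?thesis
    by (rule back_subst[where P = "openin T"])
      (use assms openin_imp_subset_carrier in \<open>auto simp: mem_l_coset_iff topspace_eq\<close>)
qed

lemma openin_set_mult: "\<lbrakk>A \<subseteq> carrier G; openin T B\<rbrakk> \<Longrightarrow> openin T (A <#> B)"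
  unfolding set_mult_eq_UN_l_coset by (intro openin_Union) (auto intro: openin_l_coset)

lemma compactin_set_mult:
  assumes "compactin T A" "compactin T B"
  shows "compactin T (A <#> B)"
proof -
  have "compactin (prod_topology T T) (A \<times> B)"
    using assms by (simp add: compactin_Times)
  from image_compactin[OF this continuous_mult] show ?thesis
    by (rule back_subst[where P = "compactin T"]) (auto simp: set_mult_def)
qed

text \<open>For x in the closure, the neighbourhood x S meets B in some b = x s, and then x = b s^-1
  with s^-1 in S.\<close>

lemma closure_of_subset_set_mult:
  assumes "openin T S" "symmetric_in G S" "\<one> \<in> S" "B \<subseteq> carrier G"
  shows "T closure_of B \<subseteq> B <#> S"
proof
  fix x
  assume x: "x \<in> T closure_of B"
  then have xc: "x \<in> carrier G"
    by (simp add: in_closure_of topspace_eq)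
  have S: "S \<subseteq> carrier G"
    using assms by (simp add: symmetric_in_def)
  have "x \<in> x <# S"
    using xc S assms by (simp add: mem_l_coset_iff)
  then obtain b where b: "b \<in> B" "b \<in> x <# S"
    using x openin_l_coset[OF xc assms(1)] unfolding in_closure_of by blast
  then have "inv (inv x \<otimes> b) \<in> S"
    using assms xc S by (auto simp: mem_l_coset_iff intro: symmetric_inD)
  then have "b \<otimes> inv (inv x \<otimes> b) \<in> B <#> S"
    using b by (intro set_multI)
  moreover have "b \<in> carrier G"
    using b assms by blast
  ultimately show "x \<in> B <#> S"
    using xc by (simp add: inv_mult_group m_assoc[symmetric])
qed

lemma openin_set_power: "openin T S \<Longrightarrow> openin T (set_power G S (Suc m))"
  using openin_set_mult set_power_closed openin_imp_subset_carrier by simp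

text \<open>In the absence of the Hausdorff axiom the compact set \<open>C\<^sup>m\<close>, with \<open>C\<close> the closure of \<open>S\<close>, need
  not be closed, so the closure of \<open>S\<^sup>m\<close> is bounded by \<open>S\<^sup>m\<^sup>+\<^sup>1\<close> instead.\<close>
lemma precompactin_set_power:
  assumes "openin T S" "symmetric_in G S" "\<one> \<in> S" "precompactin T S"
  shows "precompactin T (set_power G S m)"
proof -
  let ?C = "T closure_of S"
  have S: "S \<subseteq> carrier G"
    using assms by (simp add: symmetric_in_def)
  have compact: "compactin T (set_power G ?C k)" for k
    using assms by (induction k)
      (auto simp: precompactin_def topspace_eq intro: compactin_set_mult finite_imp_compactin)
  have mono: "set_power G S k \<subseteq> set_power G ?C k" for k
    using S by (induction k) (simp_all add: topspace_eq mono_set_mult closure_of_subset)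
  have "T closure_of set_power G S m \<subseteq> set_power G S (Suc m)"
    using closure_of_subset_set_mult[OF assms(1-3) set_power_closed[OF S]] by simp
  then have "compactin T (T closure_of set_power G S m)"
    using mono[of "Suc m"] by (intro closed_compactin[OF compact[of "Suc m"]]) auto
  then show ?thesis
    using set_power_closed[OF S] by (simp add: precompactin_def topspace_eq)
qed

end

section \<open>Haar measure of open sets and their translates\<close>

context left_haar_measure
begin

lemma openin_imp_sets: "openin T U \<Longrightarrow> U \<in> sets \<mu>"
  by (simp add: sets_eq sigma_sets.Basic)

lemma closedin_imp_sets:
  assumes "closedin T C"
  shows "C \<in> sets \<mu>"
proof -
  have "space \<mu> - (topspace T - C) \<in> sets \<mu>"
    using assms openin_imp_sets by (intro sets.compl_sets) (auto simp: closedin_def)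
  then show ?thesis
    using closedin_subset[OF assms] by (simp add: space_eq topspace_eq double_diff)
qed

lemma fmeasurable_precompact:
  assumes "openin T U" "precompactin T U"
  shows "U \<in> fmeasurable \<mu>"
proof -
  have "T closure_of U \<in> sets \<mu>"
    by (simp add: closedin_imp_sets)
  then have "T closure_of U \<in> fmeasurable \<mu>"
    using finite_on_compact assms by (auto simp: precompactin_def fmeasurable_def)
  then show ?thesis
    by (rule fmeasurableI2) (simp_all add: assms openin_imp_sets closure_of_subset openin_subset)
qed

lemma measure_l_coset:
  "\<lbrakk>x \<in> carrier G; A \<in> sets \<mu>\<rbrakk> \<Longrightarrow> measure \<mu> (x <# A) = measure \<mu> A"
  by (simp add: measure_def left_invariant)

lemma fmeasurable_l_coset:
  "\<lbrakk>x \<in> carrier G; openin T A; A \<in> fmeasurable \<mu>\<rbrakk> \<Longrightarrow> x <# A \<in> fmeasurable \<mu>"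
  by (simp add: fmeasurable_def left_invariant openin_imp_sets openin_l_coset)

text \<open>Finitely many translates of U cover any given compact set. If U were null, every
  measurable compact set would be null, and inner regularity would make the whole group
  null.\<close>

lemma emeasure_openin_pos:
  assumes U: "openin T U" "U \<noteq> {}"
  shows "emeasure \<mu> U > 0"
proof (rule ccontr)
  assume "\<not> ?thesis"
  then have zero: "emeasure \<mu> U = 0"
    by simp
  obtain u where u: "u \<in> U" "u \<in> carrier G"
    using U openin_imp_subset_carrier by blast
  have null: "emeasure \<mu> C = 0" if C: "compactin T C" "C \<in> sets \<mu>" for C
  proof -
    have "C \<subseteq> \<Union>((\<lambda>x. x <# U) ` carrier G)"
    proof
      fix c
      assume "c \<in> C"
      then have c: "c \<in> carrier G"
        using compactin_subset_topspace[OF C(1)] topspace_eq by auto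
      then have "c \<in> (c \<otimes> inv u) <# U"
        using u openin_imp_subset_carrier[OF U(1)]
        by (simp add: mem_l_coset_iff inv_mult_group m_assoc)
      then show "c \<in> \<Union>((\<lambda>x. x <# U) ` carrier G)"
        using c u by (intro UN_I[of "c \<otimes> inv u"]) auto
    qed
    moreover have "\<forall>V\<in>(\<lambda>x. x <# U) ` carrier G. openin T V"
      using openin_l_coset U by blast
    ultimately obtain \<F> where "finite \<F>" "\<F> \<subseteq> (\<lambda>x. x <# U) ` carrier G" "C \<subseteq> \<Union>\<F>"
      using C(1) unfolding compactin_def by meson
    then obtain X where X: "finite X" "X \<subseteq> carrier G" "C \<subseteq> (\<Union>x\<in>X. x <# U)"
      by (metis finite_subset_image)
    have "emeasure \<mu> C \<le> emeasure \<mu> (\<Union>x\<in>X. x <# U)"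
      using X U by (intro emeasure_mono sets.finite_UN) (auto intro: openin_imp_sets openin_l_coset)
    also have "\<dots> \<le> (\<Sum>x\<in>X. emeasure \<mu> (x <# U))"
      using X U by (intro emeasure_subadditive_finite) (auto intro: openin_imp_sets openin_l_coset)
    also have "\<dots> = 0"
      using X U zero by (auto simp: left_invariant openin_imp_sets intro!: sum.neutral)
    finally show ?thesis
      by simp
  qed
  have "emeasure \<mu> (carrier G) =
      (SUP C\<in>{C. compactin T C \<and> C \<in> sets \<mu> \<and> C \<subseteq> carrier G}. emeasure \<mu> C)"
    using inner_regular[of "carrier G"] openin_topspace[of T] by (simp add: topspace_eq)
  also have "\<dots> \<le> 0"
    using null by (intro SUP_least) auto
  finally show False
    using nonzero by simp
qed

section \<open>The almost stabilizer and its covering properties\<close>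

text \<open>For symmetric A this is a superlevel set of the convolution of the indicator function of
  A with itself. It is the set H of the argument when t = 1 / (4 K).\<close>

definition almost_stabilizer :: "'a set \<Rightarrow> real \<Rightarrow> 'a set" where
  "almost_stabilizer A t = {x \<in> carrier G. t * measure \<mu> A \<le> measure \<mu> (A \<inter> (x <# A))}"

lemma one_mem_almost_stabilizer:
  "\<lbrakk>openin T A; t \<le> 1\<rbrakk> \<Longrightarrow> \<one> \<in> almost_stabilizer A t"
  using mult_right_mono[of t 1 "measure \<mu> A"]
  by (simp add: almost_stabilizer_def lcos_mult_one openin_imp_subset_carrier)

text \<open>By left invariance the overlap depends on x^-1 y alone, so a large overlap of two
  translates amounts to membership of \<open>inv x \<otimes> y\<close> in the almost
  stabilizer.\<close>

lemma measure_translates_Int: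
  assumes "openin T A" "x \<in> carrier G" "y \<in> carrier G"
  shows "measure \<mu> ((x <# A) \<inter> (y <# A)) = measure \<mu> (A \<inter> ((inv x \<otimes> y) <# A))"
proof -
  have A: "A \<subseteq> carrier G"
    using assms openin_imp_subset_carrier by blast
  have "(x <# A) \<inter> (y <# A) = x <# (A \<inter> ((inv x \<otimes> y) <# A))"
    using assms A by (simp add: l_coset_Int l_coset_closed lcos_m_assoc m_assoc[symmetric])
  then show ?thesis
    using assms by (simp add: measure_l_coset openin_imp_sets openin_l_coset openin_Int)
qed

lemma symmetric_in_almost_stabilizer:
  assumes "openin T A"
  shows "symmetric_in G (almost_stabilizer A t)"
proof (rule symmetric_inI)
  show "inv x \<in> almost_stabilizer A t" if "x \<in> almost_stabilizer A t" for x
    using that measure_translates_Int[OF assms, of x \<one>] assms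
    by (simp add: almost_stabilizer_def lcos_mult_one openin_imp_subset_carrier Int_commute)
qed (auto simp: almost_stabilizer_def)

text \<open>Translates are added one at a time. Each new one meets the union of the earlier ones in
  measure at most mu(A) / 2, and so contributes at least mu(A) / 2.\<close>

lemma measure_UN_almost_disjoint_translates:
  fixes K :: real
  assumes A: "openin T A" "A \<in> fmeasurable \<mu>" and "K > 0"
    and F: "finite F" "F \<subseteq> carrier G" "real (card F) \<le> 2 * K + 1"
    and sep: "pairwise (\<lambda>x y. measure \<mu> ((x <# A) \<inter> (y <# A)) < measure \<mu> A / (4 * K)) F"
  shows "real (card F) * (measure \<mu> A / 2) \<le> measure \<mu> (\<Union>x\<in>F. x <# A)"
  using F sep
proof (induction F rule: finite_induct)
  case (insert x F)
  let ?U = "\<Union>y\<in>F. y <# A"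
  have fm: "y <# A \<in> fmeasurable \<mu>" if "y \<in> insert x F" for y
    using that insert.prems A fmeasurable_l_coset by blast
  then have U: "?U \<in> fmeasurable \<mu>"
    using insert.hyps by (intro fmeasurable.finite_UN) auto
  have "measure \<mu> (?U \<inter> (x <# A)) \<le> (\<Sum>y\<in>F. measure \<mu> ((y <# A) \<inter> (x <# A)))"
    unfolding Int_UN_distrib2 UN_simps(4)[symmetric] using insert.hyps fm
    by (intro order_trans[OF _ measure_UNION_le]) (auto intro!: fmeasurableD)
  also have "\<dots> \<le> real (card F) * (measure \<mu> A / (4 * K))"
    using insert.prems insert.hyps
    by (intro sum_bounded_above) (auto simp: pairwise_def intro!: less_imp_le)
  \<comment> \<open>The bound 2 K + 1 counts the new translate as well, so at most 2 K precede
    it.\<close>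
  also have "\<dots> \<le> 2 * K * (measure \<mu> A / (4 * K))"
    using insert.prems insert.hyps \<open>K > 0\<close> by (intro mult_right_mono) auto
  also have "\<dots> = measure \<mu> A / 2"
    using \<open>K > 0\<close> by simp
  finally have small: "measure \<mu> (?U \<inter> (x <# A)) \<le> measure \<mu> A / 2" .
  have "measure \<mu> (?U \<union> (x <# A)) =
      measure \<mu> ?U + measure \<mu> (x <# A) - measure \<mu> (?U \<inter> (x <# A))"
    using U fm by (intro measure_Un3) auto
  moreover have "measure \<mu> (x <# A) = measure \<mu> A"
    using A insert.prems by (simp add: measure_l_coset)
  moreover have "real (card F) * (measure \<mu> A / 2) \<le> measure \<mu> ?U"
    using insert by (auto simp: pairwise_insert)
  ultimately show ?case
    using insert.hyps small by (simp add: Un_commute algebra_simps)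
qed simp

text \<open>More than 2 K almost disjoint translates of A by elements of A would fill more than K
  mu(A) inside A A. For a maximal such family X, every a in A outside X has a translate overlapping
  some x A in at least mu(A) / (4 K), which puts x^-1 a into the almost stabilizer.\<close>

lemma covered_by_almost_stabilizer:
  fixes K :: real
  assumes A: "openin T A" "A \<in> fmeasurable \<mu>" "measure \<mu> A > 0"
    and AA: "A <#> A \<in> fmeasurable \<mu>" "measure \<mu> (A <#> A) \<le> K * measure \<mu> A" and "1 \<le> K"
  obtains X where "finite X" "X \<subseteq> A" "real (card X) \<le> 2 * K"
    "A \<subseteq> X <#> almost_stabilizer A (1 / (4 * K))"
proof -
  let ?P = "\<lambda>x y. measure \<mu> ((x <# A) \<inter> (y <# A)) < measure \<mu> A / (4 * K)"
  have Ac: "A \<subseteq> carrier G"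
    using A openin_imp_subset_carrier by blast
  have bound: "real (card F) \<le> 2 * K" if F: "finite F" "F \<subseteq> A" "pairwise ?P F" for F
  proof (rule ccontr)
    assume "\<not> ?thesis"
    \<comment> \<open>The family is first cut down to floor(2 K) + 1 members: still more than 2 K,
      but within the range 2 K + 1 allowed for estimating the union.\<close>
    then have "nat \<lfloor>2 * K\<rfloor> + 1 \<le> card F"
      using \<open>1 \<le> K\<close> by (simp add: Suc_le_eq nat_less_iff floor_less_iff)
    then obtain F' where F': "F' \<subseteq> F" "card F' = nat \<lfloor>2 * K\<rfloor> + 1" "finite F'"
      by (meson obtain_subset_with_card_n)
    have c: "2 * K < real (card F')" "real (card F') \<le> 2 * K + 1"
      using F'(2) \<open>1 \<le> K\<close> by linarith+
    have "real (card F') * (measure \<mu> A / 2) \<le> measure \<mu> (\<Union>x\<in>F'. x <# A)"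
      using F F' A \<open>1 \<le> K\<close> Ac c
      by (intro measure_UN_almost_disjoint_translates[of A K]) (auto intro: pairwise_subset)
    also have "\<dots> \<le> measure \<mu> (A <#> A)"
      using F F' A AA Ac
      by (intro measure_mono_fmeasurable sets.finite_UN UN_least l_coset_subset_set_mult)
        (auto intro!: openin_imp_sets openin_l_coset)
    also have "\<dots> \<le> K * measure \<mu> A"
      by (rule AA)
    finally show False
      using c A by (simp add: field_simps)
  qed
  have "symp ?P"
    by (auto simp: symp_def Int_commute)
  from maximal_separated[OF bound this] obtain X where X: "finite X" "X \<subseteq> A" "pairwise ?P X"
    and max: "\<And>a. a \<in> A - X \<Longrightarrow> \<exists>x\<in>X. \<not> ?P x a"
    by blast
  have "a \<in> X <#> almost_stabilizer A (1 / (4 * K))" if a: "a \<in> A" for a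
  proof (cases "a \<in> X")
    case True
    have "a \<otimes> \<one> \<in> X <#> almost_stabilizer A (1 / (4 * K))"
      using True A \<open>1 \<le> K\<close> by (intro set_multI one_mem_almost_stabilizer) auto
    then show ?thesis
      using a Ac by auto
  next
    case False
    then obtain x where x: "x \<in> X" "\<not> ?P x a"
      using max a by blast
    have c: "x \<in> carrier G" "a \<in> carrier G"
      using x X a Ac by auto
    have "inv x \<otimes> a \<in> almost_stabilizer A (1 / (4 * K))"
      using x c measure_translates_Int[OF A(1) c] by (simp add: almost_stabilizer_def)
    then have "x \<otimes> (inv x \<otimes> a) \<in> X <#> almost_stabilizer A (1 / (4 * K))"
      using x by (intro set_multI)
    then show ?thesis
      using c by (simp add: m_assoc[symmetric])
  qed
  then show thesis
    using that[of X] X bound by blast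
qed

text \<open>A substitute for the double-counting argument through convolutions, which would need Fubini's
  theorem for non-\<open>\<sigma>\<close>-finite or non-second-countable \<open>G\<close>: the points of \<open>H\<^sup>m\<close> are funnelled into a
  single translate of \<open>A\<close> by applying the pigeonhole principle to one factor at a time.\<close>
lemma many_in_one_translate:
  fixes K t :: real
  assumes A: "openin T A" "A \<in> fmeasurable \<mu>" "measure \<mu> A > 0" "symmetric_in G A" "\<one> \<in> A"
    and AA: "A <#> A \<in> fmeasurable \<mu>" "measure \<mu> (A <#> A) \<le> K * measure \<mu> A"
    and "K > 0" "t > 0"
    and I: "finite I" "\<And>i. i \<in> I \<Longrightarrow> z i \<in> set_power G (almost_stabilizer A t) m"
  shows "\<exists>g\<in>carrier G. real (card I) * (t / K) ^ m \<le> real (card {i\<in>I. z i \<in> g <# A})"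
  using I(2)
proof (induction m arbitrary: z)
  case 0
  then have "{i\<in>I. z i \<in> \<one> <# A} = I"
    using A openin_imp_subset_carrier by (auto simp: lcos_mult_one)
  then show ?case
    by (intro bexI[of _ \<one>]) auto
next
  case (Suc m)
  let ?H = "almost_stabilizer A t"
  have Ac: "A \<subseteq> carrier G" and Hc: "?H \<subseteq> carrier G"
    using A openin_imp_subset_carrier by (auto simp: almost_stabilizer_def)
  have "\<forall>i\<in>I. \<exists>w h. w \<in> set_power G ?H m \<and> h \<in> ?H \<and> z i = w \<otimes> h"
    using Suc.prems by (fastforce elim!: set_multE)
  then obtain w h where wh: "\<And>i. i \<in> I \<Longrightarrow> w i \<in> set_power G ?H m"
    "\<And>i. i \<in> I \<Longrightarrow> h i \<in> ?H" "\<And>i. i \<in> I \<Longrightarrow> z i = w i \<otimes> h i"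
    by metis
  have c: "w i \<in> carrier G" "h i \<in> carrier G" if "i \<in> I" for i
    using wh that Hc set_power_closed[OF Hc] by blast+
  \<comment> \<open>The induction hypothesis is applied to the family w over the same index set:
    distinct \<open>z i\<close> may share a factor \<open>w i\<close>, so indices are counted and
    not points.\<close>
  obtain g where g: "g \<in> carrier G"
    "real (card I) * (t / K) ^ m \<le> real (card {i\<in>I. w i \<in> g <# A})"
    using Suc.IH[of w] wh by blast
  let ?J = "{i\<in>I. w i \<in> g <# A}"
  \<comment> \<open>\<open>E i\<close> is the overlap of \<open>w i <# A\<close> and
    \<open>z i <# A\<close>. The first set confines it to g A A for i in \<open>?J\<close>, the
    second ties it to \<open>z i\<close>, and its measure is at least t mu(A) because
    \<open>h i\<close> lies in the almost stabilizer.\<close>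
  define E where "E i = w i <# (A \<inter> (h i <# A))" for i
  have op: "openin T (A \<inter> (h i <# A))" if "i \<in> I" for i
    using A c that by (intro openin_Int openin_l_coset) auto
  have E_eq: "E i = (w i <# A) \<inter> (z i <# A)" if "i \<in> I" for i
    using that Ac c wh by (simp add: E_def l_coset_Int l_coset_closed lcos_m_assoc)
  have sub: "E i \<subseteq> g <# (A <#> A)" if "i \<in> ?J" for i
  proof -
    obtain a where a: "a \<in> A" "w i = g \<otimes> a"
      using \<open>i \<in> ?J\<close> by (auto simp: l_coset_def)
    have "E i \<subseteq> w i <# A"
      using that by (auto simp: E_eq)
    also have "\<dots> = g <# (a <# A)"
      using a g Ac by (simp add: lcos_m_assoc subset_iff)
    also have "\<dots> \<subseteq> g <# (A <#> A)"
      using l_coset_subset_set_mult[OF a(1)] by (auto simp: l_coset_def)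
    finally show ?thesis .
  qed
  have AAo: "openin T (A <#> A)"
    using A Ac by (intro openin_set_mult)
  have fin: "finite ?J" and ne: "g <# (A <#> A) \<noteq> {}"
    using I set_multI[OF A(5) A(5), of G] by (auto simp: l_coset_def)
  have meas: "E i \<in> sets \<mu>" if "i \<in> ?J" for i
    using that op c by (auto simp: E_def intro!: openin_imp_sets openin_l_coset)
  have fm: "g <# (A <#> A) \<in> fmeasurable \<mu>"
    using g AAo AA by (intro fmeasurable_l_coset)
  \<comment> \<open>The set g A A has measure at most K mu(A), so b lies in at least a fraction t /
    K of the sets \<open>E i\<close> with i in \<open>?J\<close>.\<close>
  obtain b where b: "b \<in> g <# (A <#> A)"
    "(\<Sum>i\<in>?J. measure \<mu> (E i)) \<le> real (card {i\<in>?J. b \<in> E i}) * measure \<mu> (g <# (A <#> A))"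
    by (rule measure_pigeonhole[OF fin meas sub fm ne])
  have bc: "b \<in> carrier G"
    using b g Ac by (auto simp: mem_l_coset_iff set_mult_closed)
  \<comment> \<open>By symmetry of A, b in z A is equivalent to z in b A, so b can replace g as the
    centre of the common translate.\<close>
  have Eb: "{i\<in>?J. b \<in> E i} \<subseteq> {i\<in>I. z i \<in> b <# A}"
  proof clarify
    fix i
    assume i: "i \<in> I" "b \<in> E i"
    then have zc: "z i \<in> carrier G"
      using c wh by simp
    have "inv (z i) \<otimes> b \<in> A"
      using i zc Ac by (simp add: E_eq mem_l_coset_iff)
    from symmetric_inD[OF A(4) this] show "z i \<in> b <# A"
      using zc bc Ac by (simp add: mem_l_coset_iff inv_mult_group)
  qed
  have "real (card ?J) * (t * measure \<mu> A) = (\<Sum>i\<in>?J. t * measure \<mu> A)"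
    by simp
  also have "\<dots> \<le> (\<Sum>i\<in>?J. measure \<mu> (E i))"
    using wh(2) c op by (intro sum_mono)
      (auto simp: E_def almost_stabilizer_def measure_l_coset openin_imp_sets)
  also have "\<dots> \<le> real (card {i\<in>?J. b \<in> E i}) * measure \<mu> (A <#> A)"
    using b g AAo by (simp add: measure_l_coset openin_imp_sets)
  also have "\<dots> \<le> real (card {i\<in>I. z i \<in> b <# A}) * (K * measure \<mu> A)"
    using AA I Eb by (intro mult_mono) (auto intro!: card_mono)
  finally have "real (card ?J) * (t / K) \<le> real (card {i\<in>I. z i \<in> b <# A})"
    using A \<open>K > 0\<close> by (simp add: field_simps)
  moreover have "real (card I) * (t / K) ^ Suc m \<le> real (card ?J) * (t / K)"
    unfolding power_Suc2 mult.assoc[symmetric]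
    using g(2) \<open>K > 0\<close> \<open>t > 0\<close> by (intro mult_right_mono) auto
  ultimately show ?case
    using bc by force
qed

text \<open>Take a maximal family of disjoint translates z A with z in H^m. A fraction (t / K)^m of
  the z lie in one g A, and their translates are disjoint inside g A A, so there are at most K of
  these. By maximality each h A with h in H^m meets some z A, whence h lies in z A A.\<close>

lemma almost_stabilizer_power_covering:
  fixes K t :: real
  assumes A: "openin T A" "A \<in> fmeasurable \<mu>" "measure \<mu> A > 0" "symmetric_in G A" "\<one> \<in> A"
    and AA: "A <#> A \<in> fmeasurable \<mu>" "measure \<mu> (A <#> A) \<le> K * measure \<mu> A"
    and "K > 0" "t > 0"
  obtains Z where "finite Z" "Z \<subseteq> carrier G" "real (card Z) \<le> K * (K / t) ^ m"
    "set_power G (almost_stabilizer A t) m \<subseteq> Z <#> (A <#> A)"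
proof -
  let ?H = "set_power G (almost_stabilizer A t) m"
  let ?P = "\<lambda>x y. (x <# A) \<inter> (y <# A) = {}"
  have Ac: "A \<subseteq> carrier G" and Hc: "?H \<subseteq> carrier G"
    using A openin_imp_subset_carrier by (auto simp: almost_stabilizer_def intro!: set_power_closed)
  have bound: "real (card F) \<le> K * (K / t) ^ m" if F: "finite F" "F \<subseteq> ?H" "pairwise ?P F" for F
  proof -
    obtain g where g: "g \<in> carrier G"
      "real (card F) * (t / K) ^ m \<le> real (card {z\<in>F. z \<in> g <# A})"
      using many_in_one_translate[OF assms F(1), of "\<lambda>z. z" m] F by blast
    let ?J = "{z\<in>F. z \<in> g <# A}"
    have AAo: "openin T (A <#> A)"
      using A Ac by (intro openin_set_mult)
    have fm: "g <# (A <#> A) \<in> fmeasurable \<mu>"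
      using g AAo AA by (intro fmeasurable_l_coset)
    have sub: "z <# A \<subseteq> g <# (A <#> A)" if "z \<in> ?J" for z
    proof -
      obtain a where a: "a \<in> A" "z = g \<otimes> a"
        using \<open>z \<in> ?J\<close> by (auto simp: l_coset_def)
      then have "z <# A = g <# (a <# A)"
        using g Ac by (simp add: lcos_m_assoc subset_iff)
      also have "\<dots> \<subseteq> g <# (A <#> A)"
        using l_coset_subset_set_mult[OF a(1)] by (auto simp: l_coset_def)
      finally show ?thesis .
    qed
    have zc: "z \<in> carrier G" if "z \<in> ?J" for z
      using that F Hc by blast
    have meas: "z <# A \<in> sets \<mu>" if "z \<in> ?J" for z
      using zc[OF that] A(1) by (intro openin_imp_sets openin_l_coset)
    have fin: "emeasure \<mu> (z <# A) \<noteq> \<infinity>" if "z \<in> ?J" for z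
      using fmeasurable_l_coset[OF zc[OF that] A(1,2)] by (auto simp: fmeasurable_def)
    have "real (card ?J) * measure \<mu> A = (\<Sum>z\<in>?J. measure \<mu> (z <# A))"
      using zc A by (simp add: measure_l_coset openin_imp_sets)
    also have "\<dots> = measure \<mu> (\<Union>z\<in>?J. z <# A)"
      using F meas fin by (intro measure_finite_Union[symmetric])
        (auto simp: disjoint_family_on_def pairwise_def)
    also have "\<dots> \<le> measure \<mu> (g <# (A <#> A))"
      using F(1) fm sub meas by (intro measure_mono_fmeasurable sets.finite_UN UN_least) auto
    also have "\<dots> \<le> K * measure \<mu> A"
      using g AAo AA by (simp add: measure_l_coset openin_imp_sets)
    finally have "real (card ?J) \<le> K"
      using A by simp
    with g(2) have "real (card F) * (t / K) ^ m \<le> K"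
      by linarith
    then have "real (card F) * (t / K) ^ m * (K / t) ^ m \<le> K * (K / t) ^ m"
      using \<open>K > 0\<close> \<open>t > 0\<close> by (intro mult_right_mono) auto
    then show ?thesis
      using \<open>K > 0\<close> \<open>t > 0\<close> by (simp add: mult.assoc power_mult_distrib[symmetric])
  qed
  have "symp ?P"
    by (auto simp: symp_def)
  from maximal_separated[OF bound this] obtain Z where Z: "finite Z" "Z \<subseteq> ?H" "pairwise ?P Z"
    and max: "\<And>h. h \<in> ?H - Z \<Longrightarrow> \<exists>z\<in>Z. \<not> ?P z h"
    by blast
  have "h \<in> Z <#> (A <#> A)" if h: "h \<in> ?H" for h
  proof -
    have "\<exists>z\<in>Z. \<not> ?P z h"
    proof (cases "h \<in> Z")
      case True
      then show ?thesis
        using A(5) by (intro bexI[of _ h]) (auto simp: l_coset_def)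
    qed (use max h in blast)
    then obtain z u where z: "z \<in> Z" "u \<in> z <# A" "u \<in> h <# A"
      by blast
    have c: "z \<in> carrier G" "h \<in> carrier G" "u \<in> carrier G"
      using z h Z Hc Ac by (auto simp: mem_l_coset_iff subset_iff)
    have "inv (inv h \<otimes> u) \<in> A"
      using z c Ac A(4) by (intro symmetric_inD) (auto simp: mem_l_coset_iff)
    moreover have "inv z \<otimes> u \<in> A"
      using z c Ac by (simp add: mem_l_coset_iff)
    ultimately have "z \<otimes> (inv z \<otimes> u \<otimes> inv (inv h \<otimes> u)) \<in> Z <#> (A <#> A)"
      using z by (intro set_multI)
    moreover have "z \<otimes> (inv z \<otimes> u \<otimes> inv (inv h \<otimes> u)) = h"
      using c by (simp add: inv_mult_group m_assoc[symmetric])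
    ultimately show ?thesis
      by simp
  qed
  then show thesis
    using that[of Z] Z Hc bound by blast
qed

end

section \<open>Covering powers of S by translates of S^(2n)\<close>

context left_haar_measure
begin

text \<open>One q serves for all j, so the same covering gives the tripling bound (j = 2) and the
  approximate group (j = 3). The exponent (4 j + 1) q counts the factors H; the extra 1 absorbs the
  number of cells and the leading K of the covering of a power of H.\<close>

lemma small_doubling_covering:
  fixes K :: real
  assumes "1 \<le> K" and S: "openin T S" "precompactin T S" "symmetric_in G S" "\<one> \<in> S"
    and n: "8 * K ^ 4 \<le> real n"
    and doubling: "measure \<mu> (set_power G S (2 * n)) \<le> K * measure \<mu> (set_power G S n)"
  obtains q :: nat where "1 \<le> q" "real q \<le> 5 powr (4 * K ^ 4)"
    "\<And>j. \<exists>Z. finite Z \<and> Z \<subseteq> carrier G \<and> real (card Z) \<le> (4 * K\<^sup>2) ^ ((4 * j + 1) * q + 1) \<and>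
       set_power G S (Suc j * n) \<subseteq> Z <#> set_power G S (2 * n)"
proof -
  let ?A = "set_power G S n"
  let ?H = "almost_stabilizer ?A (1 / (4 * K))"
  have Sc: "S \<subseteq> carrier G"
    using S by (simp add: symmetric_in_def)
  have K4: "K \<le> K ^ 4"
    using \<open>1 \<le> K\<close> by (intro self_le_power) auto
  have "0 < n"
    using n K4 \<open>1 \<le> K\<close> by (intro Nat.gr0I) auto
  then obtain n' where n': "n = Suc n'"
    using gr0_implies_Suc by blast
  have AA: "?A <#> ?A = set_power G S (2 * n)"
    by (simp add: set_power_add[OF Sc] mult_2)
  have op: "openin T (set_power G S k)" if "0 < k" for k
    using that openin_set_power[OF S(1)] by (cases k) auto
  have fm: "set_power G S k \<in> fmeasurable \<mu>" if "0 < k" for k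
    using that S by (intro fmeasurable_precompact op precompactin_set_power)
  have A: "openin T ?A" "?A \<in> fmeasurable \<mu>" "symmetric_in G ?A" "\<one> \<in> ?A"
    using op fm \<open>0 < n\<close> S by (simp_all add: symmetric_in_set_power one_mem_set_power)
  have pos: "measure \<mu> ?A > 0"
    using emeasure_openin_pos[OF A(1)] A(2,4)
    by (auto simp: emeasure_eq_measure2)
  have fmAA: "?A <#> ?A \<in> fmeasurable \<mu>"
    using fm[of "2 * n"] \<open>0 < n\<close> by (simp add: AA)
  have dAA: "measure \<mu> (?A <#> ?A) \<le> K * measure \<mu> ?A"
    using doubling by (simp add: AA)
  obtain X where X: "finite X" "X \<subseteq> ?A" "real (card X) \<le> 2 * K" "?A \<subseteq> X <#> ?H"
    using covered_by_almost_stabilizer[OF A(1,2) pos fmAA dAA \<open>1 \<le> K\<close>] by blast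
  have H: "symmetric_in G ?H" "\<one> \<in> ?H" "?H \<subseteq> carrier G"
    using A \<open>1 \<le> K\<close> symmetric_in_almost_stabilizer[OF A(1)]
    by (auto simp: one_mem_almost_stabilizer symmetric_in_def)
  have Xc: "X \<subseteq> carrier G"
    using X(2) set_power_closed[OF Sc] by blast
  obtain Y q where Y: "Y \<subseteq> X" "1 \<le> q" "q \<le> 5 ^ card X" "?A \<subseteq> Y <#> set_power G ?H q"
    and sep: "\<forall>x\<in>Y. \<forall>y\<in>Y. x \<noteq> y \<longrightarrow> inv x \<otimes> y \<notin> set_power G ?H (4 * q)"
    using separated_subcover[OF X(1) Xc H(1,2) X(4)] by (elim exE conjE)
  let ?H' = "set_power G ?H q"
  have Yfin: "finite Y" "card Y \<le> card X" "Y \<subseteq> carrier G"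
    using Y X Xc by (auto intro: finite_subset card_mono)
  have cY: "real (card Y) \<le> 2 * K"
    using Yfin X by linarith
  \<comment> \<open>2 K <= 8 K^4 <= n. The later bound \<open>2 * r \<le> n\<close> uses 4 K <= 8
    K^4 in the same way.\<close>
  have cn: "card Y \<le> n"
    using cY n K4 \<open>1 \<le> K\<close> by linarith
  have sep': "\<forall>x\<in>Y. \<forall>y\<in>Y. x \<noteq> y \<longrightarrow> inv x \<otimes> y \<notin> set_power G ?H' 4"
    using sep unfolding set_power_mult[OF H(3)] mult.commute[of 4 q] .
  obtain r where r: "r < card Y" "?A \<subseteq> set_power G S r <#> set_power G ?H' 2"
    by (rule power_subset_thickened_power[OF Yfin(1,3) symmetric_in_set_power[OF H(1)]
        one_mem_set_power[OF H(2)] Sc S(4) Y(4) sep' cn])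
  have "2 * r \<le> n"
    using r(1) cY n K4 \<open>1 \<le> K\<close> by linarith
  have sub: "set_power G S (Suc j * n) \<subseteq> Y <#> set_power G ?H ((4 * j + 1) * q)" for j
  proof -
    have "set_power G S (Suc j * n) \<subseteq> ?A <#> set_power G ?H' (4 * j)"
      by (rule power_subset_thickening[OF Sc S(4) set_power_closed[OF H(3)] r(2) \<open>2 * r \<le> n\<close>])
    also have "\<dots> \<subseteq> (Y <#> ?H') <#> set_power G ?H' (4 * j)"
      using Y(4) by (rule mono_set_mult) simp
    also have "\<dots> = Y <#> (?H' <#> set_power G ?H' (4 * j))"
      using H(3) Yfin by (intro set_mult_assoc) (simp_all add: set_power_closed)
    also have "\<dots> = Y <#> set_power G ?H ((4 * j + 1) * q)"
      unfolding set_power_mult[OF H(3)] set_power_add[OF H(3), symmetric]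
      by (simp add: distrib_right mult.commute[of q] add.commute)
    finally show ?thesis .
  qed
  show thesis
  proof (rule that[OF Y(2)])
    have "real q \<le> real (5 ^ card X)"
      using Y(3) by (simp only: of_nat_le_iff)
    also have "\<dots> = 5 powr real (card X)"
      by (simp add: powr_realpow)
    \<comment> \<open>\<open>card X\<close> is at most 2 K, which is relaxed to 4 K^4.\<close>
    also have "\<dots> \<le> 5 powr (4 * K ^ 4)"
      using X(3) K4 \<open>1 \<le> K\<close> by (intro powr_mono) auto
    finally show "real q \<le> 5 powr (4 * K ^ 4)" .
  next
    fix j
    let ?m = "(4 * j + 1) * q"
    have "1 / (4 * K) > 0" "K > 0"
      using \<open>1 \<le> K\<close> by auto
    then obtain Z where Z: "finite Z" "Z \<subseteq> carrier G"
      "real (card Z) \<le> K * (K / (1 / (4 * K))) ^ ?m"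
      "set_power G ?H ?m \<subseteq> Z <#> (?A <#> ?A)"
      using almost_stabilizer_power_covering[OF A(1,2) pos A(3,4) fmAA dAA, where m = ?m]
      by metis
    have YZ: "Y <#> Z = (\<lambda>(y, z). y \<otimes> z) ` (Y \<times> Z)"
      by (auto simp: set_mult_def)
    have "card (Y <#> Z) \<le> card Y * card Z"
      unfolding YZ using card_image_le[of "Y \<times> Z"] Yfin(1) Z(1) by (simp add: card_cartesian_product)
    then have "real (card (Y <#> Z)) \<le> real (card Y) * real (card Z)"
      by (simp flip: of_nat_mult)
    \<comment> \<open>Here K / t = 4 K^2, since t = 1 / (4 K).\<close>
    also have "\<dots> \<le> (2 * K) * (K * (4 * K\<^sup>2) ^ ?m)"
      using cY Z(3) \<open>1 \<le> K\<close> by (intro mult_mono) (auto simp: power2_eq_square mult_ac)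
    also have "\<dots> = (2 * K\<^sup>2) * (4 * K\<^sup>2) ^ ?m"
      by (simp add: power2_eq_square)
    also have "\<dots> \<le> (4 * K\<^sup>2) * (4 * K\<^sup>2) ^ ?m"
      by (intro mult_right_mono) auto
    finally have "real (card (Y <#> Z)) \<le> (4 * K\<^sup>2) ^ (?m + 1)"
      by simp
    moreover have "set_power G S (Suc j * n) \<subseteq> (Y <#> Z) <#> set_power G S (2 * n)"
    proof -
      have "set_power G S (Suc j * n) \<subseteq> Y <#> set_power G ?H ?m"
        by (rule sub)
      also have "\<dots> \<subseteq> Y <#> (Z <#> (?A <#> ?A))"
        using Z(4) by (intro mono_set_mult) auto
      also have "\<dots> = (Y <#> Z) <#> set_power G S (2 * n)"
        unfolding AA using Yfin Z(2) set_power_closed[OF Sc] by (intro set_mult_assoc[symmetric])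
      finally show ?thesis .
    qed
    moreover have "finite (Y <#> Z)"
      unfolding YZ using Yfin Z by blast
    ultimately show "\<exists>Z. finite Z \<and> Z \<subseteq> carrier G \<and>
        real (card Z) \<le> (4 * K\<^sup>2) ^ (?m + 1) \<and>
        set_power G S (Suc j * n) \<subseteq> Z <#> set_power G S (2 * n)"
      using Yfin Z by (intro exI[of _ "Y <#> Z"]) (simp add: set_mult_closed)
  qed
qed

lemma emeasure_le_covering:
  assumes "finite Z" "Z \<subseteq> carrier G" "openin T B" "A \<subseteq> Z <#> B"
  shows "emeasure \<mu> A \<le> of_nat (card Z) * emeasure \<mu> B"
proof -
  have "emeasure \<mu> A \<le> emeasure \<mu> (\<Union>z\<in>Z. z <# B)"
    using assms by (intro emeasure_mono sets.finite_UN)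
      (auto simp: set_mult_eq_UN_l_coset intro: openin_imp_sets openin_l_coset)
  also have "\<dots> \<le> (\<Sum>z\<in>Z. emeasure \<mu> (z <# B))"
    using assms by (intro emeasure_subadditive_finite) (auto intro: openin_imp_sets openin_l_coset)
  also have "\<dots> = (\<Sum>z\<in>Z. emeasure \<mu> B)"
    using assms by (intro sum.cong refl left_invariant openin_imp_sets) auto
  finally show ?thesis
    by simp
qed

end

section \<open>The constants and the theorem\<close>

text \<open>Six factors 4 K^2 make 2^12 K^12, at most 2^12 K^24, so c q powers of the latter
  dominate 6 c q powers of 4 K^2. The uses are c = 10 with N = 9 q + 2 and c = 30 with N = 13 q +
  1.\<close>

lemma power_le_powr_bound:
  fixes K Q :: real and N c q :: nat
  assumes "1 \<le> K" "real q \<le> Q" "N \<le> 6 * (c * q)"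
  shows "(4 * K\<^sup>2) ^ N \<le> (2 ^ 12 * K ^ 24) powr (real c * Q)"
proof -
  have K: "1 \<le> K ^ k" for k
    using assms(1) by simp
  have "(4 * K\<^sup>2) ^ N \<le> (4 * K\<^sup>2) ^ (6 * (c * q))"
    using assms(3) K[of 2] by (intro power_increasing) auto
  also have "\<dots> = (2 ^ 12 * K ^ 12) ^ (c * q)"
    unfolding power_mult[of _ 6] by (simp add: power_mult_distrib flip: power_mult)
  also have "\<dots> \<le> (2 ^ 12 * K ^ 24) ^ (c * q)"
    using assms(1) by (intro power_mono mult_left_mono power_increasing) auto
  also have "\<dots> = (2 ^ 12 * K ^ 24) powr real (c * q)"
    using assms(1) by (intro powr_realpow[symmetric]) (simp add: zero_less_mult_iff)
  also have "\<dots> \<le> (2 ^ 12 * K ^ 24) powr (real c * Q)"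
    using K[of 24] assms(2) by (intro powr_mono) (auto intro: mult_left_mono)
  finally show ?thesis .
qed

theorem theorem1p2:
  fixes G :: "('a, 'b) monoid_scheme" and T :: "'a topology" and \<mu> :: "'a measure"
    and K :: real and S :: "'a set" and n :: nat
  assumes "locally_compact_group G T"
    and "left_haar_measure G T \<mu>"
    and "1 \<le> K"
    and "S \<subseteq> carrier G" and "precompactin T S" and "symmetric_in G S" and "openin T S"
    and "\<one>\<^bsub>G\<^esub> \<in> S"
    and "8 * K ^ 4 \<le> real n"
    and "emeasure \<mu> (set_power G S (2 * n)) \<le> ennreal K * emeasure \<mu> (set_power G S n)"
  shows "emeasure \<mu> (set_power G S (3 * n))
           \<le> ennreal ((2 ^ 12 * K ^ 24) powr (10 * 5 powr (4 * K ^ 4)))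
              * emeasure \<mu> (set_power G S n)
       \<and> precompactin T (set_power G S (2 * n))
       \<and> openin T (set_power G S (2 * n))
       \<and> approximate_group G ((2 ^ 12 * K ^ 24) powr (30 * 5 powr (4 * K ^ 4)))
           (set_power G S (2 * n))"
proof -
  interpret left_haar_measure G T \<mu>
    by fact
  let ?P = "set_power G S" and ?Q = "5 powr (4 * K ^ 4)" and ?L = "2 ^ 12 * K ^ 24"
  note S = \<open>openin T S\<close> \<open>precompactin T S\<close> \<open>symmetric_in G S\<close> \<open>\<one>\<^bsub>G\<^esub> \<in> S\<close>
  have "0 < n"
    using assms(3,9) one_le_power[of K 4] by (intro Nat.gr0I) auto
  have op: "openin T (?P k)" if "0 < k" for k
    using that openin_set_power[OF S(1)] by (cases k) auto
  have pre: "precompactin T (?P k)" for k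
    using S by (intro precompactin_set_power)
  have fm: "?P k \<in> fmeasurable \<mu>" if "0 < k" for k
    using that by (intro fmeasurable_precompact op pre)
  \<comment> \<open>Both powers are open and precompact, hence of finite measure, so the doubling
    inequality passes to real numbers.\<close>
  have "measure \<mu> (?P (2 * n)) \<le> K * measure \<mu> (?P n)"
    using assms(10) fm[of n] fm[of "2 * n"] \<open>0 < n\<close> \<open>1 \<le> K\<close>
    by (simp add: emeasure_eq_measure2 ennreal_mult[symmetric])
  then obtain q where q: "1 \<le> q" "real q \<le> ?Q"
    and cover: "\<And>j. \<exists>Z. finite Z \<and> Z \<subseteq> carrier G \<and>
       real (card Z) \<le> (4 * K\<^sup>2) ^ ((4 * j + 1) * q + 1) \<and> ?P (Suc j * n) \<subseteq> Z <#>\<^bsub>G\<^esub> ?P (2 * n)"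
    using small_doubling_covering[OF assms(3) S assms(9)] by blast
  obtain Z where Z: "finite Z" "Z \<subseteq> carrier G" "real (card Z) \<le> (4 * K\<^sup>2) ^ (9 * q + 1)"
    "?P (3 * n) \<subseteq> Z <#>\<^bsub>G\<^esub> ?P (2 * n)"
    using cover[of 2] by (auto simp: numeral_3_eq_3)
  \<comment> \<open>The factor K pays for passing from S^(2n) back to S^n and is absorbed by one
    more factor 4 K^2.\<close>
  have "real (card Z) * K \<le> (4 * K\<^sup>2) ^ (9 * q + 1) * (4 * K\<^sup>2)"
    using Z(3) \<open>1 \<le> K\<close> self_le_power[of K 2] by (intro mult_mono) auto
  also have "\<dots> = (4 * K\<^sup>2) ^ (9 * q + 2)"
    by simp
  also have "\<dots> \<le> ?L powr (real 10 * ?Q)"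
    using q by (intro power_le_powr_bound[OF \<open>1 \<le> K\<close> q(2)]) auto
  finally have bound: "real (card Z) * K \<le> ?L powr (10 * ?Q)"
    by simp
  have "emeasure \<mu> (?P (3 * n)) \<le> of_nat (card Z) * emeasure \<mu> (?P (2 * n))"
    using Z op \<open>0 < n\<close> by (intro emeasure_le_covering) auto
  also have "\<dots> \<le> of_nat (card Z) * (ennreal K * emeasure \<mu> (?P n))"
    by (intro mult_left_mono assms(10)) simp
  also have "\<dots> = ennreal (real (card Z) * K) * emeasure \<mu> (?P n)"
    using \<open>1 \<le> K\<close> by (simp add: ennreal_mult ennreal_of_nat_eq_real_of_nat mult.assoc)
  also have "\<dots> \<le> ennreal (?L powr (10 * ?Q)) * emeasure \<mu> (?P n)"
    using bound by (intro mult_right_mono ennreal_leI) auto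
  finally have tripling:
    "emeasure \<mu> (?P (3 * n)) \<le> ennreal (?L powr (10 * ?Q)) * emeasure \<mu> (?P n)" .
  \<comment> \<open>The square of S^(2n) is S^(4n), which is the case j = 3.\<close>
  obtain W where W: "finite W" "W \<subseteq> carrier G" "real (card W) \<le> (4 * K\<^sup>2) ^ (13 * q + 1)"
    "?P (4 * n) \<subseteq> W <#>\<^bsub>G\<^esub> ?P (2 * n)"
    using cover[of 3] by auto
  note W(3)
  also have "(4 * K\<^sup>2) ^ (13 * q + 1) \<le> ?L powr (real 30 * ?Q)"
    using q by (intro power_le_powr_bound[OF \<open>1 \<le> K\<close> q(2)]) auto
  finally have cardW: "real (card W) \<le> ?L powr (30 * ?Q)"
    by simp
  have "1 * 1 \<le> ?L"
    using \<open>1 \<le> K\<close> by (intro mult_mono) auto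
  then have "1 \<le> ?L powr (30 * ?Q)"
    by (intro ge_one_powr_ge_zero) auto
  moreover have "set_power G (?P (2 * n)) 2 = ?P (4 * n)"
    by (simp add: set_power_mult[OF assms(4)])
  ultimately have "approximate_group G (?L powr (30 * ?Q)) (?P (2 * n))"
    unfolding approximate_group_def using W cardW S
    by (auto simp: symmetric_in_set_power one_mem_set_power set_mult_eq_UN_l_coset
        simp del: set_power.simps intro!: exI[of _ W])
  with tripling pre op \<open>0 < n\<close> show ?thesis
    by simp
qed

end
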